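(* For $i=1,2$ let $(\mathfrak P^{(i)},\mathfrak T^{(i)},\mathfrak e^{(i)})$ be a state system with measurements (as defined in the context), with poset of states $\mathfrak S^{(i)}$ in which every pure state is maximal, and let $\mathfrak U^{(i)}$ be a scheme of discriminating generalized yes/no tests on $\mathfrak S^{(i)}$, with associated orthogonality relation $\perp$ on $\mathfrak S^{(i)}\setminus\{\bot\}$. Let $(\widetilde f,f^\ast)$ be a symmetry from $(\mathfrak S^{(1)},\mathfrak T^{(1)},\widetilde{\mathfrak e}^{(1)})$ to $(\mathfrak S^{(2)},\mathfrak T^{(2)},\widetilde{\mathfrak e}^{(2)})$ preserving the schemes, $f^\ast(\mathfrak U^{(2)})=\mathfrak U^{(1)}$. Then for all $\sigma_1,\sigma_2\in\mathfrak S^{(1)}\setminus\{\bot\}$, $$\sigma_1\perp\sigma_2\ \Rightarrow\ \widetilde f(\sigma_1)\perp\widetilde f(\sigma_2).$$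
   Context: Let $\mathfrak B=\{\bot,\mathbf Y,\mathbf N\}$ with partial order $u\le v$ iff $u=\bot$ or $u=v$, and involution $\overline{\bot}=\bot$, $\overline{\mathbf Y}=\mathbf N$, $\overline{\mathbf N}=\mathbf Y$. The data are: sets $\mathfrak P$ and $\mathfrak T$ (yes/no tests), a map $\mathfrak e:\mathfrak P\times\mathfrak T\to\mathfrak B$, a map $\mathfrak t\mapsto\overline{\mathfrak t}$ on $\mathfrak T$ with $\mathfrak e(\mathfrak p,\overline{\mathfrak t})=\overline{\mathfrak e(\mathfrak p,\mathfrak t)}$, and, with $\mathfrak A_{\mathfrak t}=\{\mathfrak p\mid\mathfrak e(\mathfrak p,\mathfrak t)=\mathbf Y\}$, $\mathfrak Q_{\mathfrak t}=\{\mathfrak p\mid\mathfrak e(\mathfrak p,\mathfrak t)\le\mathbf Y\}$: measurement maps $\mathfrak Q_{\mathfrak t}\to\mathfrak P$, $\mathfrak p\mapsto\mathfrak p\cdot\mathfrak t$; and an associative succession $\mathfrak t_1\cdot\mathfrak t_2\in\mathfrak T$ with $\mathfrak A_{\mathfrak t_1\cdot\mathfrak t_2}=\{\mathfrak p\in\mathfrak A_{\mathfrak t_1}\mid\mathfrak p\cdot\mathfrak t_1\in\mathfrak A_{\mathfrak t_2}\}$, $\mathfrak Q_{\mathfrak t_1\cdot\mathfrak t_2}=\{\mathfrak p\in\mathfrak Q_{\mathfrak t_1}\mid\mathfrak p\cdot\mathfrak t_1\in\mathfrak Q_{\mathfrak t_2}\}$, $\mathfrak A_{\overline{\mathfrak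 t_1\cdot\mathfrak t_2}}=\mathfrak A_{\overline{\mathfrak t_1}}\cup\{\mathfrak p\in\mathfrak Q_{\mathfrak t_1}\mid\mathfrak p\cdot\mathfrak t_1\in\mathfrak A_{\overline{\mathfrak t_2}}\}$, $\mathfrak p\cdot(\mathfrak t_1\cdot\mathfrak t_2)=(\mathfrak p\cdot\mathfrak t_1)\cdot\mathfrak t_2$. Put $\mathfrak p_1\sim\mathfrak p_2$ iff $\mathfrak e(\mathfrak p_1,\mathfrak t)=\mathfrak e(\mathfrak p_2,\mathfrak t)$ for all $\mathfrak t$; $\mathfrak S=\mathfrak P/\sim$ (states), $\lceil\mathfrak p\rceil$ the class of $\mathfrak p$, $\widetilde{\mathfrak e}_{\mathfrak t}(\lceil\mathfrak p\rceil)=\mathfrak e(\mathfrak p,\mathfrak t)$, $\lceil\mathfrak p\rceil\cdot\mathfrak t=\lceil\mathfrak p\cdot\mathfrak t\rceil$ (well defined), and $\sigma_1\sqsubseteq\sigma_2$ iff $\widetilde{\mathfrak e}_{\mathfrak t}(\sigma_1)\le\widetilde{\mathfrak e}_{\mathfrak t}(\sigma_2)$ for all $\mathfrak t$. $\sqcap,\inf,\sqcup,\bigsqcup$ are infima and suprema in $\mathfrak S$; $\sqsubset$ is strict order; $\sigma\lessdot\tau$ means $\tau$ covers $\sigma$. A state system with measurements is such data satisfying: (A1) for every nonempty $P\subseteq\mathfrak P$ there is a unique element of $\mathfrak P$, denoted $\inf P$, with $\mathfrak e(\inf P,\mathfrak t)=\bigwedge_{\mathfrak p\in P}\mathfrak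 e(\mathfrak p,\mathfrak t)$ for all $\mathfrak t$; (A2) there is a unique $\mathfrak p_\bot$ with $\mathfrak e(\mathfrak p_\bot,\mathfrak t)=\bot$ for all $\mathfrak t$ (its class $\bot$ is the bottom of $\mathfrak S$); (A3) every nonempty chain in $\mathfrak S$ has a supremum; (A4) if $\widetilde{\mathfrak e}_{\mathfrak t}(\bigsqcup\mathfrak C)=\mathbf Y$ for a nonempty chain $\mathfrak C$ then $\widetilde{\mathfrak e}_{\mathfrak t}(\sigma)=\mathbf Y$ for some $\sigma\in\mathfrak C$; (A5) if $\sigma\sqsubset\sigma'$ there is $\sigma''$ with $\sigma\lessdot\sigma''\sqsubseteq\sigma'$; (A6) (a) if $\sigma_1\sqsubseteq\sigma_2\sqsubseteq\sigma_2'$ there is $\sigma_1'$ with $\sigma_1=\sigma_1'\sqcap\sigma_2$, $\sigma_2'=\sigma_1'\sqcup\sigma_2$; (b) if $\sigma_1'\sqsubseteq\sigma_2'$, $\sigma_2\lessdot\sigma_2'$, $\sigma_1'\not\sqsubseteq\sigma_2$, then $(\sigma_1'\sqcap\sigma_2)\lessdot\sigma_1'$; (c) if $\sigma_1\sqsubseteq\sigma_1'\sqsubseteq\sigma_2'$, $\sigma_1\lessdot\sigma_2\sqsubseteq\sigma_2'$, $\sigma_2\not\sqsubseteq\sigma_1'$, then $\sigma_1'\lessdot(\sigma_1'\sqcup\sigma_2)$. A state $\sigma$ is pure if for nonempty $S\subseteq\mathfrak S$, $\sigma=\inf S$ implies $\sigma\in S$. States are consistent if they have a common upper bound. A generalized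 yes/no test is a pair $\mathfrak t_{(\Sigma,\Sigma')}$ of inconsistent states, with evaluation $\widetilde{\mathfrak e}_{\mathfrak t_{(\Sigma,\Sigma')}}(\sigma)=\mathbf Y$ if $\Sigma\sqsubseteq\sigma$, $\mathbf N$ if $\Sigma'\sqsubseteq\sigma$, $\bot$ otherwise; its conjugate is $\mathfrak t_{(\Sigma',\Sigma)}$. It is discriminating if moreover $\Sigma$ is consistent with every $x\sqsubset\Sigma'$ and $\Sigma'$ with every $x\sqsubset\Sigma$. A scheme is a set $\mathfrak U$ of generalized tests which is complete (for each $\Sigma\ne\bot$ there is $\Sigma'$ with $\mathfrak t_{(\Sigma,\Sigma')}\in\mathfrak U$), irredundant (for $\mathfrak t_{(\Sigma_1,\Sigma_1')},\mathfrak t_{(\Sigma_2,\Sigma_2')}\in\mathfrak U$: $\Sigma_1\sqsubseteq\Sigma_2\Leftrightarrow\Sigma_2'\sqsubseteq\Sigma_1'$) and closed (stable under conjugation, and under $(\mathfrak t_{(\Sigma_1,\Sigma_1')},\mathfrak t_{(\Sigma_2,\Sigma_2')})\mapsto\mathfrak t_{(\Sigma_1\sqcup\Sigma_2,\Sigma_1'\sqcap\Sigma_2')}$ when $\Sigma_1,\Sigma_2$ are consistent). For $\sigma_1,\sigma_2\ne\bot$: $\sigma_1\perp\sigma_2$ iff there is $\mathfrak t_{(\Sigma,\Sigma')}\in\mathfrak U$ with $\Sigma\sqsubseteq\sigma_1$, $\Sigma'\sqsubseteq\sigma_2$. A symmetry is a pair $\widetilde f:\mathfrak S^{(1)}\to\mathfrak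 S^{(2)}$, $f^\ast:\mathfrak T^{(2)}\to\mathfrak T^{(1)}$ with: $\widetilde{\mathfrak e}^{(2)}_{\mathfrak t}(\widetilde f(\sigma))=\widetilde{\mathfrak e}^{(1)}_{f^\ast(\mathfrak t)}(\sigma)$; $\widetilde f(\sigma)\cdot\mathfrak t=\widetilde f(\sigma\cdot f^\ast(\mathfrak t))$ when defined; $f^\ast(\mathfrak t\cdot\mathfrak t')=f^\ast(\mathfrak t)\cdot f^\ast(\mathfrak t')$; $\widetilde f$ injective; $f^\ast$ surjective. The map $f^\ast$ is also defined on the generalized tests in $\mathfrak U^{(2)}$, where it satisfies the same identity $\widetilde{\mathfrak e}^{(2)}_{\mathfrak u}(\widetilde f(\sigma))=\widetilde{\mathfrak e}^{(1)}_{f^\ast(\mathfrak u)}(\sigma)$. *)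

theory Defs
  imports "HOL-Algebra.Order"
begin

section \<open>Outcomes\<close>

datatype outcome = Undef | Yes | No

instantiation outcome :: order_bot
begin

definition less_eq_outcome :: "outcome \<Rightarrow> outcome \<Rightarrow> bool"
  where "u \<le> v \<longleftrightarrow> u = Undef \<or> u = (v::outcome)"

definition less_outcome :: "outcome \<Rightarrow> outcome \<Rightarrow> bool"
  where "u < v \<longleftrightarrow> u \<le> v \<and> u \<noteq> (v::outcome)"

definition bot_outcome :: outcome
  where "bot = Undef"

instance
  by standard (auto simp: less_eq_outcome_def less_outcome_def bot_outcome_def)

end

fun flip :: "outcome \<Rightarrow> outcome" where
  "flip Undef = Undef"
| "flip Yes = No"
| "flip No = Yes"

definition Meet :: "outcome set \<Rightarrow> outcome"
  where "Meet B = (GREATEST u. \<forall>b\<in>B. u \<le> b)"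

lemma le_Meet_iff:
  assumes "B \<noteq> {}"
  shows "u \<le> Meet B \<longleftrightarrow> (\<forall>b\<in>B. u \<le> b)"
proof -
  obtain m where m: "\<forall>b\<in>B. m \<le> b" "\<And>u. \<forall>b\<in>B. u \<le> b \<Longrightarrow> u \<le> m"
  proof (cases "\<exists>b. B = {b}")
    case True
    then show ?thesis using that by auto
  next
    case False
    with assms obtain b c where "b \<in> B" "c \<in> B" "b \<noteq> c" by blast
    then show ?thesis
      by (intro that[of Undef]) (auto simp: less_eq_outcome_def, metis)
  qed
  have "Meet B = m" unfolding Meet_def
    by (rule Greatest_equality) (use m in auto)
  with m show ?thesis by (blast intro: order_trans)
qed


section \<open>Order-theoretic notions\<close>

definition covers :: "('a, 'b) gorder_scheme \<Rightarrow> 'a \<Rightarrow> 'a \<Rightarrow> bool"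
    (infix \<open>\<lessdot>\<index>\<close> 50)
  where "x \<lessdot>\<^bsub>L\<^esub> y \<longleftrightarrow> x \<in> carrier L \<and> y \<in> carrier L \<and> x \<sqsubset>\<^bsub>L\<^esub> y \<and>
    \<not> (\<exists>z\<in>carrier L. x \<sqsubset>\<^bsub>L\<^esub> z \<and> z \<sqsubset>\<^bsub>L\<^esub> y)"

definition pure :: "('a, 'b) gorder_scheme \<Rightarrow> 'a \<Rightarrow> bool"
  where "pure L x \<longleftrightarrow> x \<in> carrier L \<and>
    (\<forall>S. S \<noteq> {} \<and> S \<subseteq> carrier L \<and> is_glb L x S \<longrightarrow> x \<in> S)"

definition maximal :: "('a, 'b) gorder_scheme \<Rightarrow> 'a \<Rightarrow> bool"
  where "maximal L x \<longleftrightarrow> x \<in> carrier L \<and> \<not> (\<exists>y\<in>carrier L. x \<sqsubset>\<^bsub>L\<^esub> y)"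

definition consistent :: "('a, 'b) gorder_scheme \<Rightarrow> 'a \<Rightarrow> 'a \<Rightarrow> bool"
  where "consistent L x y \<longleftrightarrow> (\<exists>z\<in>carrier L. x \<sqsubseteq>\<^bsub>L\<^esub> z \<and> y \<sqsubseteq>\<^bsub>L\<^esub> z)"


section \<open>State systems with measurements\<close>

text \<open>The values of \<open>ev\<close>, \<open>neg\<close>, \<open>meas\<close> and \<open>suc\<close> matter only on
  \<open>preps\<close> and \<open>tests\<close>, and \<open>meas p t\<close> only where \<open>ev p t \<le> Yes\<close>.\<close>

record ('p, 't) test_space =
  preps :: "'p set"
  tests :: "'t set"
  ev :: "'p \<Rightarrow> 't \<Rightarrow> outcome"
  neg :: "'t \<Rightarrow> 't"
  meas :: "'p \<Rightarrow> 't \<Rightarrow> 'p"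
  suc :: "'t \<Rightarrow> 't \<Rightarrow> 't"

definition accepted :: "('p, 't) test_space \<Rightarrow> 't \<Rightarrow> 'p set"
  where "accepted X t = {p \<in> preps X. ev X p t = Yes}"

definition questionable :: "('p, 't) test_space \<Rightarrow> 't \<Rightarrow> 'p set"
  where "questionable X t = {p \<in> preps X. ev X p t \<le> Yes}"

definition indist :: "('p, 't) test_space \<Rightarrow> 'p rel"
  where "indist X = {(p, q). p \<in> preps X \<and> q \<in> preps X \<and> (\<forall>t\<in>tests X. ev X p t = ev X q t)}"

definition states :: "('p, 't) test_space \<Rightarrow> 'p set set"
  where "states X = preps X // indist X"

definition state_of :: "('p, 't) test_space \<Rightarrow> 'p \<Rightarrow> 'p set"
  where "state_of X p = indist X `` {p}"

text \<open>The functions induced on states are the common value on all representatives;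
  see \<open>state_ev_state_of\<close> and \<open>state_meas_state_of\<close> for well-definedness.\<close>

definition state_ev :: "('p, 't) test_space \<Rightarrow> 'p set \<Rightarrow> 't \<Rightarrow> outcome"
  where "state_ev X \<sigma> t = the_elem ((\<lambda>p. ev X p t) ` \<sigma>)"

definition state_meas :: "('p, 't) test_space \<Rightarrow> 'p set \<Rightarrow> 't \<Rightarrow> 'p set"
  where "state_meas X \<sigma> t = the_elem ((\<lambda>p. state_of X (meas X p t)) ` \<sigma>)"

definition state_order :: "('p, 't) test_space \<Rightarrow> 'p set gorder"
  where "state_order X =
    \<lparr>carrier = states X, eq = (=),
     le = \<lambda>\<sigma> \<tau>. \<forall>t\<in>tests X. state_ev X \<sigma> t \<le> state_ev X \<tau> t\<rparr>"

locale test_space_with_measurements =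
  fixes X :: "('p, 't) test_space"
  assumes neg_closed: "t \<in> tests X \<Longrightarrow> neg X t \<in> tests X"
    and ev_neg: "\<lbrakk>p \<in> preps X; t \<in> tests X\<rbrakk> \<Longrightarrow> ev X p (neg X t) = flip (ev X p t)"
    and meas_closed: "\<lbrakk>t \<in> tests X; p \<in> questionable X t\<rbrakk> \<Longrightarrow> meas X p t \<in> preps X"
    and suc_closed: "\<lbrakk>t\<^sub>1 \<in> tests X; t\<^sub>2 \<in> tests X\<rbrakk> \<Longrightarrow> suc X t\<^sub>1 t\<^sub>2 \<in> tests X"
    and suc_assoc: "\<lbrakk>t\<^sub>1 \<in> tests X; t\<^sub>2 \<in> tests X; t\<^sub>3 \<in> tests X\<rbrakk>
      \<Longrightarrow> suc X (suc X t\<^sub>1 t\<^sub>2) t\<^sub>3 = suc X t\<^sub>1 (suc X t\<^sub>2 t\<^sub>3)"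
    and accepted_suc: "\<lbrakk>t\<^sub>1 \<in> tests X; t\<^sub>2 \<in> tests X\<rbrakk>
      \<Longrightarrow> accepted X (suc X t\<^sub>1 t\<^sub>2) = {p \<in> accepted X t\<^sub>1. meas X p t\<^sub>1 \<in> accepted X t\<^sub>2}"
    and questionable_suc: "\<lbrakk>t\<^sub>1 \<in> tests X; t\<^sub>2 \<in> tests X\<rbrakk>
      \<Longrightarrow> questionable X (suc X t\<^sub>1 t\<^sub>2) =
          {p \<in> questionable X t\<^sub>1. meas X p t\<^sub>1 \<in> questionable X t\<^sub>2}"
    and accepted_neg_suc: "\<lbrakk>t\<^sub>1 \<in> tests X; t\<^sub>2 \<in> tests X\<rbrakk>
      \<Longrightarrow> accepted X (neg X (suc X t\<^sub>1 t\<^sub>2)) =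
          accepted X (neg X t\<^sub>1) \<union>
          {p \<in> questionable X t\<^sub>1. meas X p t\<^sub>1 \<in> accepted X (neg X t\<^sub>2)}"
    and meas_suc: "\<lbrakk>t\<^sub>1 \<in> tests X; t\<^sub>2 \<in> tests X; p \<in> questionable X (suc X t\<^sub>1 t\<^sub>2)\<rbrakk>
      \<Longrightarrow> meas X p (suc X t\<^sub>1 t\<^sub>2) = meas X (meas X p t\<^sub>1) t\<^sub>2"

text \<open>Infima and suprema are stated relationally, so that existence is part of each
  formula and no junk value of a choice operator can enter.\<close>

locale state_system = test_space_with_measurements X
  for X :: "('p, 't) test_space" +
  fixes L (structure)
  defines L_def: "L \<equiv> state_order X"
  assumes inf_preps: "\<lbrakk>P \<noteq> {}; P \<subseteq> preps X\<rbrakk>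
      \<Longrightarrow> \<exists>!q. q \<in> preps X \<and> (\<forall>t\<in>tests X. ev X q t = Meet ((\<lambda>p. ev X p t) ` P))"
    and bot_prep: "\<exists>!p. p \<in> preps X \<and> (\<forall>t\<in>tests X. ev X p t = Undef)"
    and chain_sup: "\<lbrakk>C \<noteq> {}; C \<subseteq> carrier L; Complete_Partial_Order.chain (\<sqsubseteq>) C\<rbrakk>
      \<Longrightarrow> \<exists>\<tau>. is_lub L \<tau> C"
    and chain_sup_Yes: "\<lbrakk>C \<noteq> {}; C \<subseteq> carrier L; Complete_Partial_Order.chain (\<sqsubseteq>) C;
        is_lub L \<tau> C; t \<in> tests X; state_ev X \<tau> t = Yes\<rbrakk>
      \<Longrightarrow> \<exists>\<sigma>\<in>C. state_ev X \<sigma> t = Yes"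
    and cover_below: "\<lbrakk>\<sigma> \<in> carrier L; \<sigma>' \<in> carrier L; \<sigma> \<sqsubset> \<sigma>'\<rbrakk>
      \<Longrightarrow> \<exists>\<sigma>''\<in>carrier L. \<sigma> \<lessdot> \<sigma>'' \<and> \<sigma>'' \<sqsubseteq> \<sigma>'"
    and relative_complement:
      "\<lbrakk>\<sigma>\<^sub>1 \<in> carrier L; \<sigma>\<^sub>2 \<in> carrier L; \<sigma>\<^sub>2' \<in> carrier L; \<sigma>\<^sub>1 \<sqsubseteq> \<sigma>\<^sub>2; \<sigma>\<^sub>2 \<sqsubseteq> \<sigma>\<^sub>2'\<rbrakk>
      \<Longrightarrow> \<exists>\<sigma>\<^sub>1'\<in>carrier L. is_glb L \<sigma>\<^sub>1 {\<sigma>\<^sub>1', \<sigma>\<^sub>2} \<and> is_lub L \<sigma>\<^sub>2' {\<sigma>\<^sub>1', \<sigma>\<^sub>2}"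
    and meet_covered:
      "\<lbrakk>\<sigma>\<^sub>1' \<in> carrier L; \<sigma>\<^sub>2 \<in> carrier L; \<sigma>\<^sub>2' \<in> carrier L;
        \<sigma>\<^sub>1' \<sqsubseteq> \<sigma>\<^sub>2'; \<sigma>\<^sub>2 \<lessdot> \<sigma>\<^sub>2'; \<not> \<sigma>\<^sub>1' \<sqsubseteq> \<sigma>\<^sub>2\<rbrakk>
      \<Longrightarrow> \<exists>\<mu>. is_glb L \<mu> {\<sigma>\<^sub>1', \<sigma>\<^sub>2} \<and> \<mu> \<lessdot> \<sigma>\<^sub>1'"
    and join_covers:
      "\<lbrakk>\<sigma>\<^sub>1 \<in> carrier L; \<sigma>\<^sub>1' \<in> carrier L; \<sigma>\<^sub>2 \<in> carrier L; \<sigma>\<^sub>2' \<in> carrier L;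
        \<sigma>\<^sub>1 \<sqsubseteq> \<sigma>\<^sub>1'; \<sigma>\<^sub>1' \<sqsubseteq> \<sigma>\<^sub>2'; \<sigma>\<^sub>1 \<lessdot> \<sigma>\<^sub>2; \<sigma>\<^sub>2 \<sqsubseteq> \<sigma>\<^sub>2'; \<not> \<sigma>\<^sub>2 \<sqsubseteq> \<sigma>\<^sub>1'\<rbrakk>
      \<Longrightarrow> \<exists>\<nu>. is_lub L \<nu> {\<sigma>\<^sub>1', \<sigma>\<^sub>2} \<and> \<sigma>\<^sub>1' \<lessdot> \<nu>"


subsection \<open>Sanity checks\<close>

lemma equiv_indist: "equiv (preps X) (indist X)"
  by (rule equivI) (auto simp: indist_def refl_on_def sym_def trans_def)

lemma state_ev_state_of:
  assumes "p \<in> preps X" "t \<in> tests X"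
  shows "state_ev X (state_of X p) t = ev X p t"
proof -
  have "(\<lambda>q. ev X q t) ` state_of X p = {ev X p t}"
    using assms by (auto simp: state_of_def indist_def)
  then show ?thesis by (simp add: state_ev_def)
qed

lemma states_eq: "states X = state_of X ` preps X"
  by (auto simp: states_def state_of_def quotient_def)

lemma state_of_eq_iff:
  assumes "p \<in> preps X" "q \<in> preps X"
  shows "state_of X p = state_of X q \<longleftrightarrow> (\<forall>t\<in>tests X. ev X p t = ev X q t)"
  using assms eq_equiv_class_iff[OF equiv_indist assms] by (simp add: state_of_def indist_def)

lemma partial_order_state_order: "partial_order (state_order X)"
proof (unfold_locales, simp_all add: state_order_def)
  fix \<sigma> \<tau> assume "\<sigma> \<in> states X" "\<tau> \<in> states X"
    and le: "\<forall>t\<in>tests X. state_ev X \<sigma> t \<le> state_ev X \<tau> t"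
      "\<forall>t\<in>tests X. state_ev X \<tau> t \<le> state_ev X \<sigma> t"
  then obtain p q where "p \<in> preps X" "q \<in> preps X" "\<sigma> = state_of X p" "\<tau> = state_of X q"
    by (auto simp: states_eq)
  moreover from this le have "\<forall>t\<in>tests X. ev X p t = ev X q t"
    by (simp add: state_ev_state_of order_class.order_eq_iff[of "ev X p _"])
  ultimately show "\<sigma> = \<tau>" by (simp add: state_of_eq_iff)
qed (meson order_trans)

lemma (in test_space_with_measurements) ev_meas_cong:
  assumes p: "p \<in> questionable X t" and q: "q \<in> questionable X t"
    and t: "t \<in> tests X" and s: "s \<in> tests X"
    and pq: "\<And>u. u \<in> tests X \<Longrightarrow> ev X p u = ev X q u"
  shows "ev X (meas X p t) s = ev X (meas X q t) s"
proof -
  have No: "ev X (meas X x t) s' = No \<longleftrightarrow> ev X x (suc X t s') = No"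
    if x: "x \<in> questionable X t" and s': "s' \<in> tests X" for x s'
  proof -
    have flip_Yes: "flip u = Yes \<longleftrightarrow> u = No" for u by (cases u) auto
    have xp: "x \<in> preps X" "ev X x t \<noteq> No" "meas X x t \<in> preps X"
      using x meas_closed[OF t x] by (auto simp: questionable_def less_eq_outcome_def)
    have "ev X x (suc X t s') = No \<longleftrightarrow> x \<in> accepted X (neg X (suc X t s'))"
      using xp t s' by (simp add: accepted_def ev_neg suc_closed flip_Yes)
    also have "\<dots> \<longleftrightarrow> meas X x t \<in> accepted X (neg X s')"
      using xp x t s' by (simp add: accepted_neg_suc) (simp add: accepted_def ev_neg flip_Yes)
    also have "\<dots> \<longleftrightarrow> ev X (meas X x t) s' = No"
      using xp s' by (simp add: accepted_def ev_neg flip_Yes)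
    finally show ?thesis by simp
  qed
  have Yes: "ev X (meas X x t) s = Yes \<longleftrightarrow> ev X (meas X x t) (neg X s) = No"
    if x: "x \<in> questionable X t" for x
    using meas_closed[OF t x] s by (cases "ev X (meas X x t) s") (auto simp: ev_neg)
  have "ev X (meas X p t) s = No \<longleftrightarrow> ev X (meas X q t) s = No"
    using No[OF p s] No[OF q s] pq t s by (simp add: suc_closed)
  moreover have "ev X (meas X p t) s = Yes \<longleftrightarrow> ev X (meas X q t) s = Yes"
    using Yes[OF p] Yes[OF q] No[OF p] No[OF q] pq t s by (simp add: suc_closed neg_closed)
  ultimately show ?thesis by (metis outcome.exhaust)
qed

lemma (in test_space_with_measurements) state_meas_state_of:
  assumes "t \<in> tests X" "p \<in> questionable X t"
  shows "state_meas X (state_of X p) t = state_of X (meas X p t)"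
proof -
  have "state_of X (meas X q t) = state_of X (meas X p t)" if "q \<in> state_of X p" for q
  proof -
    have "q \<in> questionable X t" "\<And>u. u \<in> tests X \<Longrightarrow> ev X q u = ev X p u"
      using that assms by (auto simp: state_of_def indist_def questionable_def)
    then show ?thesis
      using assms ev_meas_cong[of q t p] by (simp add: state_of_eq_iff meas_closed)
  qed
  moreover have "p \<in> state_of X p"
    using assms by (auto simp: state_of_def indist_def questionable_def)
  ultimately have "(\<lambda>q. state_of X (meas X q t)) ` state_of X p = {state_of X (meas X p t)}"
    by blast
  then show ?thesis by (simp add: state_meas_def)
qed

text \<open>The bottom of the poset of states is the class of the preparation without
  any determined outcome.\<close>

lemma bottom_state_order:
  assumes "p \<in> preps X" "\<forall>t\<in>tests X. ev X p t = Undef"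
  shows "\<bottom>\<^bsub>state_order X\<^esub> = state_of X p"
proof -
  interpret partial_order "state_order X" by (rule partial_order_state_order)
  have "least (state_order X) (state_of X p) (carrier (state_order X))"
    using assms by (auto simp: least_def state_order_def states_eq state_ev_state_of
        less_eq_outcome_def)
  then show ?thesis
    unfolding bottom_def by (metis (no_types, lifting) least_unique someI)
qed


section \<open>Generalized yes/no tests and schemes\<close>

definition gen_tests :: "('a, 'b) gorder_scheme \<Rightarrow> ('a \<times> 'a) set"
  where "gen_tests L = {(a, a'). a \<in> carrier L \<and> a' \<in> carrier L \<and> \<not> consistent L a a'}"

definition gen_ev :: "('a, 'b) gorder_scheme \<Rightarrow> 'a \<Rightarrow> 'a \<times> 'a \<Rightarrow> outcome"
  where "gen_ev L x u =
    (if fst u \<sqsubseteq>\<^bsub>L\<^esub> x then Yes else if snd u \<sqsubseteq>\<^bsub>L\<^esub> x then No else Undef)"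

definition discriminating :: "('a, 'b) gorder_scheme \<Rightarrow> 'a \<times> 'a \<Rightarrow> bool"
  where "discriminating L u \<longleftrightarrow> u \<in> gen_tests L \<and>
    (\<forall>x\<in>carrier L. x \<sqsubset>\<^bsub>L\<^esub> snd u \<longrightarrow> consistent L (fst u) x) \<and>
    (\<forall>x\<in>carrier L. x \<sqsubset>\<^bsub>L\<^esub> fst u \<longrightarrow> consistent L (snd u) x)"

locale scheme =
  fixes L :: "('a, 'b) gorder_scheme" (structure)
    and U :: "('a \<times> 'a) set"
  assumes gen_tests: "U \<subseteq> gen_tests L"
    and complete: "\<lbrakk>a \<in> carrier L; a \<noteq> \<bottom>\<rbrakk> \<Longrightarrow> \<exists>a'. (a, a') \<in> U"
    and irredundant: "\<lbrakk>(a\<^sub>1, a\<^sub>1') \<in> U; (a\<^sub>2, a\<^sub>2') \<in> U\<rbrakk> \<Longrightarrow> a\<^sub>1 \<sqsubseteq> a\<^sub>2 \<longleftrightarrow> a\<^sub>2' \<sqsubseteq> a\<^sub>1'"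
    and closed_conj: "(a, a') \<in> U \<Longrightarrow> (a', a) \<in> U"
    and closed_join: "\<lbrakk>(a\<^sub>1, a\<^sub>1') \<in> U; (a\<^sub>2, a\<^sub>2') \<in> U; consistent L a\<^sub>1 a\<^sub>2\<rbrakk>
      \<Longrightarrow> \<exists>b b'. is_lub L b {a\<^sub>1, a\<^sub>2} \<and> is_glb L b' {a\<^sub>1', a\<^sub>2'} \<and> (b, b') \<in> U"

definition orth :: "('a, 'b) gorder_scheme \<Rightarrow> ('a \<times> 'a) set \<Rightarrow> 'a \<Rightarrow> 'a \<Rightarrow> bool"
  where "orth L U x\<^sub>1 x\<^sub>2 \<longleftrightarrow>
    x\<^sub>1 \<in> carrier L - {\<bottom>\<^bsub>L\<^esub>} \<and> x\<^sub>2 \<in> carrier L - {\<bottom>\<^bsub>L\<^esub>} \<and>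
    (\<exists>(a, a')\<in>U. a \<sqsubseteq>\<^bsub>L\<^esub> x\<^sub>1 \<and> a' \<sqsubseteq>\<^bsub>L\<^esub> x\<^sub>2)"


section \<open>Symmetries\<close>

definition symmetry ::
    "('p1, 't1) test_space \<Rightarrow> ('p2, 't2) test_space \<Rightarrow> ('p1 set \<Rightarrow> 'p2 set) \<Rightarrow> ('t2 \<Rightarrow> 't1) \<Rightarrow> bool"
  where "symmetry X\<^sub>1 X\<^sub>2 f g \<longleftrightarrow>
    f \<in> states X\<^sub>1 \<rightarrow> states X\<^sub>2 \<and> g \<in> tests X\<^sub>2 \<rightarrow> tests X\<^sub>1 \<and>
    (\<forall>\<sigma>\<in>states X\<^sub>1. \<forall>t\<in>tests X\<^sub>2. state_ev X\<^sub>2 (f \<sigma>) t = state_ev X\<^sub>1 \<sigma> (g t)) \<and>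
    (\<forall>\<sigma>\<in>states X\<^sub>1. \<forall>t\<in>tests X\<^sub>2. state_ev X\<^sub>2 (f \<sigma>) t \<le> Yes \<longrightarrow>
      state_meas X\<^sub>2 (f \<sigma>) t = f (state_meas X\<^sub>1 \<sigma> (g t))) \<and>
    (\<forall>t\<in>tests X\<^sub>2. \<forall>t'\<in>tests X\<^sub>2. g (suc X\<^sub>2 t t') = suc X\<^sub>1 (g t) (g t')) \<and>
    inj_on f (states X\<^sub>1) \<and> g ` tests X\<^sub>2 = tests X\<^sub>1"

text \<open>The extension \<open>h\<close> of the pullback of tests to the generalized tests in \<open>U\<close>.  It
  needs no separate construction: there is at most one, see \<open>gen_pullback_unique\<close>.\<close>

definition gen_pullback ::
    "('a, 'c) gorder_scheme \<Rightarrow> ('b, 'd) gorder_scheme \<Rightarrow> ('b \<times> 'b) set \<Rightarrow>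
     ('a \<Rightarrow> 'b) \<Rightarrow> ('b \<times> 'b \<Rightarrow> 'a \<times> 'a) \<Rightarrow> bool"
  where "gen_pullback L\<^sub>1 L\<^sub>2 U f h \<longleftrightarrow>
    h \<in> U \<rightarrow> gen_tests L\<^sub>1 \<and>
    (\<forall>u\<in>U. \<forall>x\<in>carrier L\<^sub>1. gen_ev L\<^sub>2 (f x) u = gen_ev L\<^sub>1 x (h u))"

lemma gen_ev_inject:
  assumes "partial_order L" "u \<in> gen_tests L" "v \<in> gen_tests L"
    and eq: "\<And>x. x \<in> carrier L \<Longrightarrow> gen_ev L x u = gen_ev L x v"
  shows "u = v"
proof -
  interpret partial_order L by fact
  obtain a a' b b' where uv: "u = (a, a')" "v = (b, b')" by fastforce
  have carr: "a \<in> carrier L" "a' \<in> carrier L" "b \<in> carrier L" "b' \<in> carrier L"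
    and inc: "\<And>x. x \<in> carrier L \<Longrightarrow> \<not> (a \<sqsubseteq>\<^bsub>L\<^esub> x \<and> a' \<sqsubseteq>\<^bsub>L\<^esub> x)"
      "\<And>x. x \<in> carrier L \<Longrightarrow> \<not> (b \<sqsubseteq>\<^bsub>L\<^esub> x \<and> b' \<sqsubseteq>\<^bsub>L\<^esub> x)"
    using assms(2,3) by (auto simp: uv gen_tests_def consistent_def)
  have "a \<sqsubseteq>\<^bsub>L\<^esub> x \<longleftrightarrow> b \<sqsubseteq>\<^bsub>L\<^esub> x" "a' \<sqsubseteq>\<^bsub>L\<^esub> x \<longleftrightarrow> b' \<sqsubseteq>\<^bsub>L\<^esub> x" if "x \<in> carrier L" for x
    using eq[OF that] inc[OF that] by (auto simp: uv gen_ev_def split: if_splits)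
  with carr have "a = b" "a' = b'" by (metis le_antisym le_refl)+
  then show ?thesis by (simp add: uv)
qed

lemma gen_pullback_unique:
  assumes "partial_order L\<^sub>1" "gen_pullback L\<^sub>1 L\<^sub>2 U f h" "gen_pullback L\<^sub>1 L\<^sub>2 U f h'" "u \<in> U"
  shows "h u = h' u"
  by (rule gen_ev_inject[OF assms(1)]) (use assms(2-) in \<open>auto simp: gen_pullback_def Pi_iff\<close>)

end

theory Submission
  imports Defs
begin

text \<open>Orthogonality can be read off from evaluations: a test \<open>(a, a')\<close> in the
  scheme witnesses it exactly when it answers \<open>Yes\<close> at the first state and
  \<open>No\<close> at the second (\<open>gen_ev_eq_Yes_iff\<close>,
  \<open>gen_ev_eq_No_iff\<close>). Since \<open>h\<close> maps the second scheme onto the first, a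
  witness downstairs is the pullback of some \<open>(b, b')\<close> in the second scheme, and
  pulling back preserves evaluations, so \<open>(b, b')\<close> separates the image states in the
  same way. That these images differ from bottom comes from the witness itself, by
  \<open>inconsistent_bounds_not_bottom\<close>.\<close>

lemma bottom_states_least:
  assumes "state_system X" and "x \<in> states X"
  shows "\<bottom>\<^bsub>state_order X\<^esub> \<sqsubseteq>\<^bsub>state_order X\<^esub> x"
proof -
  obtain p where p: "p \<in> preps X" "\<forall>t\<in>tests X. ev X p t = Undef"
    using state_system.bot_prep[OF assms(1)] by blast
  then have "state_of X p \<sqsubseteq>\<^bsub>state_order X\<^esub> x"
    by (simp add: state_order_def state_ev_state_of less_eq_outcome_def)
  with p show ?thesis by (simp add: bottom_state_order)
qed

lemma gen_ev_eq_Yes_iff: "gen_ev L x (a, a') = Yes \<longleftrightarrow> a \<sqsubseteq>\<^bsub>L\<^esub> x"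
  by (simp add: gen_ev_def)

text \<open>\<open>gen_ev\<close> checks the \<open>Yes\<close> component first, so a state above
  both components would give \<open>Yes\<close>; inconsistency of the pair excludes this.\<close>

lemma gen_ev_eq_No_iff:
  assumes "(a, a') \<in> gen_tests L" and "x \<in> carrier L"
  shows "gen_ev L x (a, a') = No \<longleftrightarrow> a' \<sqsubseteq>\<^bsub>L\<^esub> x"
  using assms by (auto simp: gen_ev_def gen_tests_def consistent_def)

text \<open>The bottom state leaves every generalized test undetermined: a component below bottom
  would lie below the other component, making the two consistent.\<close>

lemma inconsistent_bounds_not_bottom:
  assumes "state_system X" and "(a, a') \<in> gen_tests (state_order X)"
    and "x \<in> states X"
    and "a \<sqsubseteq>\<^bsub>state_order X\<^esub> x \<or> a' \<sqsubseteq>\<^bsub>state_order X\<^esub> x"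
  shows "x \<noteq> \<bottom>\<^bsub>state_order X\<^esub>"
proof
  assume x: "x = \<bottom>\<^bsub>state_order X\<^esub>"
  interpret partial_order "state_order X" by (rule partial_order_state_order)
  have carr: "carrier (state_order X) = states X" by (simp add: state_order_def)
  have a: "a \<in> states X" "a' \<in> states X"
    and inc: "\<And>z. z \<in> states X \<Longrightarrow> \<not> (a \<sqsubseteq>\<^bsub>state_order X\<^esub> z \<and> a' \<sqsubseteq>\<^bsub>state_order X\<^esub> z)"
    using assms(2) by (auto simp: gen_tests_def consistent_def carr)
  have "x \<sqsubseteq>\<^bsub>state_order X\<^esub> a" "x \<sqsubseteq>\<^bsub>state_order X\<^esub> a'"
    using a by (simp_all add: x bottom_states_least assms(1))
  \<comment> \<open>The forbidden common upper bound is \<open>a'\<close> if \<open>a\<close> lies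
    below bottom, and \<open>a\<close> if \<open>a'\<close> does.\<close>
  with assms(3,4) a inc show False
    by (metis carr le_refl le_trans)
qed

theorem theorem17:
  fixes X\<^sub>1 :: "('p1, 't1) test_space" and X\<^sub>2 :: "('p2, 't2) test_space"
    and U\<^sub>1 :: "('p1 set \<times> 'p1 set) set" and U\<^sub>2 :: "('p2 set \<times> 'p2 set) set"
    and f :: "'p1 set \<Rightarrow> 'p2 set" and g :: "'t2 \<Rightarrow> 't1"
    and h :: "'p2 set \<times> 'p2 set \<Rightarrow> 'p1 set \<times> 'p1 set"
  assumes "state_system X\<^sub>1" and "state_system X\<^sub>2"
    and "\<And>\<sigma>. pure (state_order X\<^sub>1) \<sigma> \<Longrightarrow> maximal (state_order X\<^sub>1) \<sigma>"
    and "\<And>\<sigma>. pure (state_order X\<^sub>2) \<sigma> \<Longrightarrow> maximal (state_order X\<^sub>2) \<sigma>"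
    and "scheme (state_order X\<^sub>1) U\<^sub>1" and "\<And>u. u \<in> U\<^sub>1 \<Longrightarrow> discriminating (state_order X\<^sub>1) u"
    and "scheme (state_order X\<^sub>2) U\<^sub>2" and "\<And>u. u \<in> U\<^sub>2 \<Longrightarrow> discriminating (state_order X\<^sub>2) u"
    and "symmetry X\<^sub>1 X\<^sub>2 f g"
    and "gen_pullback (state_order X\<^sub>1) (state_order X\<^sub>2) U\<^sub>2 f h" and "h ` U\<^sub>2 = U\<^sub>1"
    and "\<sigma>\<^sub>1 \<in> states X\<^sub>1 - {\<bottom>\<^bsub>state_order X\<^sub>1\<^esub>}" and "\<sigma>\<^sub>2 \<in> states X\<^sub>1 - {\<bottom>\<^bsub>state_order X\<^sub>1\<^esub>}"
    and "orth (state_order X\<^sub>1) U\<^sub>1 \<sigma>\<^sub>1 \<sigma>\<^sub>2"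
  shows "orth (state_order X\<^sub>2) U\<^sub>2 (f \<sigma>\<^sub>1) (f \<sigma>\<^sub>2)"
proof -
  let ?L1 = "state_order X\<^sub>1" and ?L2 = "state_order X\<^sub>2"
  have carr: "carrier ?L1 = states X\<^sub>1" "carrier ?L2 = states X\<^sub>2"
    by (simp_all add: state_order_def)
  have f: "f \<sigma>\<^sub>1 \<in> states X\<^sub>2" "f \<sigma>\<^sub>2 \<in> states X\<^sub>2"
    using assms(9,12,13) by (auto simp: symmetry_def)
  obtain a a' where a: "(a, a') \<in> U\<^sub>1" "a \<sqsubseteq>\<^bsub>?L1\<^esub> \<sigma>\<^sub>1" "a' \<sqsubseteq>\<^bsub>?L1\<^esub> \<sigma>\<^sub>2"
    using assms(14) by (auto simp: orth_def)
  \<comment> \<open>Preservation of the schemes enters here, as surjectivity of \<open>h\<close>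
    onto \<open>U\<^sub>1\<close>.\<close>
  obtain b b' where b: "(b, b') \<in> U\<^sub>2" and h: "h (b, b') = (a, a')"
    using a(1) assms(11) by (auto simp: image_iff)
  have gen: "(a, a') \<in> gen_tests ?L1" "(b, b') \<in> gen_tests ?L2"
    using a(1) b scheme.gen_tests[OF assms(5)] scheme.gen_tests[OF assms(7)] by auto
  have pull: "gen_ev ?L2 (f x) (b, b') = gen_ev ?L1 x (a, a')" if "x \<in> states X\<^sub>1" for x
    using assms(10) b h that by (auto simp: gen_pullback_def carr)
  \<comment> \<open>The order relation is transferred as the outcome \<open>Yes\<close>, and the
    next one as the outcome \<open>No\<close>.\<close>
  have "b \<sqsubseteq>\<^bsub>?L2\<^esub> f \<sigma>\<^sub>1"
    using pull[of \<sigma>\<^sub>1] a(2) assms(12) by (metis DiffD1 gen_ev_eq_Yes_iff)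
  moreover have "b' \<sqsubseteq>\<^bsub>?L2\<^esub> f \<sigma>\<^sub>2"
    using pull[of \<sigma>\<^sub>2] a(3) assms(13) f(2) gen by (metis DiffD1 carr gen_ev_eq_No_iff)
  ultimately show ?thesis
    using b f inconsistent_bounds_not_bottom[OF assms(2) gen(2)] by (auto simp: orth_def carr)
qed

end
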